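(* Let $f(\boldsymbol{w})=f_\ell(\boldsymbol{A}\boldsymbol{w})+\phi_\lambda(\boldsymbol{w})$ be the objective function on $\mathbb{R}^n$ described in the context. Let $\boldsymbol{w}^1,\boldsymbol{w}^2,\ldots$ be the sequence generated by the DAL algorithm from the initial solution $\boldsymbol{w}^0$; let $W^\ast$ be the set of minimizers of $f$ and let $f(W^\ast)$ denote the minimum objective value. If the inner minimization is solved exactly (i.e. $\boldsymbol{\alpha}^t$ is an exact minimizer of $\varphi_t$ at every step $t$) and the proximity parameter $\eta_t$ is increased exponentially, then the DAL algorithm converges exponentially as follows: $$f(\boldsymbol{w}^{k+1})-f(W^\ast)\le\frac{\|\boldsymbol{w}^0-W^\ast\|^2}{2C_k},$$ where $\|\boldsymbol{w}^0-W^\ast\|$ denotes the minimum distance between the initial solution $\boldsymbol{w}^0$ and $W^\ast$, namely $\|\boldsymbol{w}^0-W^\ast\|=\min_{\boldsymbol{w}^\ast\in W^\ast}\|\boldsymbol{w}^0-\boldsymbol{w}^\ast\|$. Here $C_k=\sum_{t=0}^k\eta_t$, which also grows exponentially.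
   Context: Norms are Euclidean. Problem: minimize $f(\boldsymbol{w})=f_\ell(\boldsymbol{A}\boldsymbol{w})+\phi_\lambda(\boldsymbol{w})$ over $\boldsymbol{w}\in\mathbb{R}^n$, where $\boldsymbol{A}\in\mathbb{R}^{m\times n}$ and $\lambda>0$ is a regularization constant. Standing assumptions. The loss $f_\ell:\mathbb{R}^m\to\mathbb{R}\cup\{+\infty\}$ is a closed proper strictly convex function with Lipschitz continuous gradient of modulus $1/\gamma$: $\|\nabla f_\ell(\boldsymbol{z})-\nabla f_\ell(\boldsymbol{z}')\|\le\frac1\gamma\|\boldsymbol{z}-\boldsymbol{z}'\|$ for all $\boldsymbol{z},\boldsymbol{z}'\in\mathbb{R}^m$. Its convex conjugate $f_\ell^\ast(\boldsymbol{y})=\sup_{\boldsymbol{x}}(\boldsymbol{y}^\top\boldsymbol{x}-f_\ell(\boldsymbol{x}))$ is (essentially) twice differentiable. The regularizer $\phi_\lambda$ is a closed proper convex, possibly non-differentiable function on $\mathbb{R}^n$, and $\phi_{\eta\lambda}=\eta\phi_\lambda$ for all $\eta>0$. The set $W^\ast$ of minimizers of $f$ is nonempty. Proximity operator: $\mathrm{prox}_{g}(\boldsymbol{y})=\arg\min_{\boldsymbol{x}\in\mathbb{R}^n}\left(\frac12\|\boldsymbol{y}-\boldsymbol{x}\|^2+g(\boldsymbol{x})\right)$. Moreau envelope of the conjugate $\phi_{\lambda}^\ast$ of $\phi_\lambda$: $\Phi_{\lambda}^\ast(\boldsymbol{w})=\min_{\boldsymbol{x}\in\mathbb{R}^n}\left(\phi_{\lambda}^\ast(\boldsymbol{x})+\frac12\|\boldsymbol{x}-\boldsymbol{w}\|^2\right)$.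 DAL (dual augmented Lagrangian) algorithm. Given $\boldsymbol{w}^0\in\mathbb{R}^n$ and a non-decreasing sequence of positive proximity parameters $\eta_0\le\eta_1\le\cdots$, at each step $t=0,1,2,\ldots$ let $\boldsymbol{\alpha}^t\in\mathbb{R}^m$ be a minimizer of $$\varphi_t(\boldsymbol{\alpha})=f_\ell^\ast(-\boldsymbol{\alpha})+\frac{1}{\eta_t}\Phi_{\lambda\eta_t}^\ast(\boldsymbol{w}^t+\eta_t\boldsymbol{A}^\top\boldsymbol{\alpha})$$ (the inner minimization), and set $\boldsymbol{w}^{t+1}=\mathrm{prox}_{\phi_{\lambda\eta_t}}(\boldsymbol{w}^t+\eta_t\boldsymbol{A}^\top\boldsymbol{\alpha}^t)$. *)

theory Defs
  imports "HOL-Analysis.Analysis"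
begin

section \<open>Extended-real-valued convex functions\<close>

definition effective_domain :: "('a \<Rightarrow> ereal) \<Rightarrow> 'a set" where
  "effective_domain f = {x. f x < \<infinity>}"

text \<open>The library's \<open>epigraph\<close> only covers real-valued functions.\<close>

definition ereal_epigraph :: "('a \<Rightarrow> ereal) \<Rightarrow> ('a \<times> real) set" where
  "ereal_epigraph f = {(x, r). f x \<le> ereal r}"

definition proper_fun :: "('a \<Rightarrow> ereal) \<Rightarrow> bool" where
  "proper_fun f \<longleftrightarrow> (\<forall>x. f x \<noteq> -\<infinity>) \<and> (\<exists>x. f x \<noteq> \<infinity>)"

definition closed_fun :: "('a::topological_space \<Rightarrow> ereal) \<Rightarrow> bool" where
  "closed_fun f \<longleftrightarrow> closed (ereal_epigraph f)"

definition convex_fun :: "('a::real_vector \<Rightarrow> ereal) \<Rightarrow> bool" where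
  "convex_fun f \<longleftrightarrow> convex (ereal_epigraph f)"

definition strictly_convex_fun :: "('a::real_vector \<Rightarrow> ereal) \<Rightarrow> bool" where
  "strictly_convex_fun f \<longleftrightarrow>
     (\<forall>x\<in>effective_domain f. \<forall>y\<in>effective_domain f. \<forall>t. x \<noteq> y \<longrightarrow> 0 < t \<longrightarrow> t < 1 \<longrightarrow>
        f ((1 - t) *\<^sub>R x + t *\<^sub>R y) < ereal (1 - t) * f x + ereal t * f y)"

text \<open>A gradient existing on the whole space forces the function to be finite everywhere; this is
  made explicit because \<open>real_of_ereal\<close> maps infinite values to \<open>0\<close>.\<close>

definition lipschitz_gradient :: "real \<Rightarrow> ('a::real_inner \<Rightarrow> ereal) \<Rightarrow> bool" where
  "lipschitz_gradient L f \<longleftrightarrow>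
     (\<forall>z. \<bar>f z\<bar> \<noteq> \<infinity>) \<and>
     (\<exists>G. (\<forall>z. GDERIV (\<lambda>u. real_of_ereal (f u)) z :> G z) \<and> L-lipschitz_on UNIV G)"

definition convex_conjugate :: "('a::real_inner \<Rightarrow> ereal) \<Rightarrow> 'a \<Rightarrow> ereal" where
  "convex_conjugate f y = (SUP x. ereal (y \<bullet> x) - f x)"

text \<open>``Essentially'' is meant as in Rockafellar's essential smoothness: the condition is imposed on
  the interior of the effective domain, which is nonempty, and the norm of the gradient blows up
  along every sequence approaching the boundary.  A function that is finite and twice
  differentiable everywhere is a special case.\<close>

definition essentially_twice_differentiable :: "('a::real_inner \<Rightarrow> ereal) \<Rightarrow> bool" where
  "essentially_twice_differentiable g \<longleftrightarrow>
     (let D = interior (effective_domain g) in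
        D \<noteq> {} \<and>
        (\<exists>G. (\<forall>y\<in>D. \<bar>g y\<bar> \<noteq> \<infinity> \<and> GDERIV (\<lambda>u. real_of_ereal (g u)) y :> G y \<and> G differentiable (at y)) \<and>
             (\<forall>s y. (\<forall>i::nat. s i \<in> D) \<longrightarrow> y \<in> frontier D \<longrightarrow> s \<longlonglongrightarrow> y \<longrightarrow>
                filterlim (\<lambda>i. norm (G (s i))) at_top sequentially)))"

definition prox :: "('a::real_inner \<Rightarrow> ereal) \<Rightarrow> 'a \<Rightarrow> 'a" where
  "prox g y = (ARG_MIN (\<lambda>x. ereal (1 / 2 * (norm (y - x))\<^sup>2) + g x) x. True)"

definition moreau_envelope :: "('a::real_inner \<Rightarrow> ereal) \<Rightarrow> 'a \<Rightarrow> ereal" where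
  "moreau_envelope g w = (INF x. g x + ereal (1 / 2 * (norm (x - w))\<^sup>2))"

definition minimizers :: "('a \<Rightarrow> ereal) \<Rightarrow> 'a set" where
  "minimizers f = {w. is_arg_min f (\<lambda>_. True) w}"


section \<open>The dual augmented Lagrangian algorithm\<close>

text \<open>The regularizer is a family \<open>\<phi>\<close> indexed by the regularization constant, so that
  \<open>\<phi> (lam * \<eta> t)\<close> is the regularizer used at step \<open>t\<close>.\<close>

definition objective ::
  "(real^'m \<Rightarrow> ereal) \<Rightarrow> (real \<Rightarrow> real^'n \<Rightarrow> ereal) \<Rightarrow> real^'n^'m \<Rightarrow> real \<Rightarrow> real^'n \<Rightarrow> ereal" where
  "objective fl \<phi> A lam w = fl (A *v w) + \<phi> lam w"

definition inner_objective ::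
  "(real^'m \<Rightarrow> ereal) \<Rightarrow> (real \<Rightarrow> real^'n \<Rightarrow> ereal) \<Rightarrow> real^'n^'m \<Rightarrow> real \<Rightarrow> real \<Rightarrow> real^'n
     \<Rightarrow> real^'m \<Rightarrow> ereal" where
  "inner_objective fl \<phi> A lam \<eta> w \<alpha> =
     convex_conjugate fl (- \<alpha>) +
     ereal (1 / \<eta>) *
       moreau_envelope (convex_conjugate (\<phi> (lam * \<eta>))) (w + \<eta> *\<^sub>R (transpose A *v \<alpha>))"

definition dal_sequence ::
  "(real^'m \<Rightarrow> ereal) \<Rightarrow> (real \<Rightarrow> real^'n \<Rightarrow> ereal) \<Rightarrow> real^'n^'m \<Rightarrow> real \<Rightarrow> (nat \<Rightarrow> real)
     \<Rightarrow> (nat \<Rightarrow> real^'n) \<Rightarrow> (nat \<Rightarrow> real^'m) \<Rightarrow> bool" where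
  "dal_sequence fl \<phi> A lam \<eta> w \<alpha> \<longleftrightarrow>
     (\<forall>t. is_arg_min (inner_objective fl \<phi> A lam (\<eta> t) (w t)) (\<lambda>_. True) (\<alpha> t) \<and>
          w (Suc t) = prox (\<phi> (lam * \<eta> t)) (w t + \<eta> t *\<^sub>R (transpose A *v \<alpha> t)))"


section \<open>Exponential growth and convergence\<close>

text \<open>Growth is bounded below and above by geometric sequences, possibly with different ratios.\<close>

definition grows_exponentially :: "(nat \<Rightarrow> real) \<Rightarrow> bool" where
  "grows_exponentially g \<longleftrightarrow>
     (\<exists>a r b s. 0 < a \<and> 1 < r \<and> (\<forall>t. a * r ^ t \<le> g t \<and> g t \<le> b * s ^ t))"

definition decays_exponentially :: "(nat \<Rightarrow> ereal) \<Rightarrow> bool" where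
  "decays_exponentially g \<longleftrightarrow>
     (\<exists>M q. 0 < q \<and> q < 1 \<and> (\<forall>k. \<bar>g k\<bar> \<le> ereal (M * q ^ k)))"

end

theory Submission
  imports Defs
begin

text \<open>
  With exact inner minimization, DAL is the proximal point method in disguise. The envelope of the
  conjugate regularizer has gradient \<open>w (t + 1)\<close> at \<open>w t + \<eta> t *\<^sub>R (transpose A *v \<alpha> t)\<close>, so
  optimality of \<open>\<alpha> t\<close> forces \<open>- \<alpha> t\<close> to be the gradient of the loss at \<open>A *v w (t + 1)\<close>. Adding the
  optimality condition of the proximity operator shows that \<open>(w t - w (t + 1)) / \<eta> t\<close> is a
  subgradient of the objective at \<open>w (t + 1)\<close>. Testing this subgradient at a minimizer makes the
  weighted gaps telescope against the squared distances, and testing it at \<open>w t\<close> shows that the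
  objective decreases, so the last gap is dominated by the weighted average.
\<close>

section \<open>Limits along segments, adjoints and the convexity inequality\<close>

text \<open>Let \<open>t\<close> tend to 0 from the right. This turns minimality along a segment,
  once divided by the step \<open>t\<close>, into a first-order inequality.\<close>

lemma real_le_of_le_add_scaled:
  fixes a b c :: real
  assumes "\<And>t. 0 < t \<Longrightarrow> t < 1 \<Longrightarrow> a \<le> b + t * c"
  shows "a \<le> b"
proof (rule tendsto_lowerbound)
  show "((\<lambda>t. b + t * c) \<longlongrightarrow> b) (at_right 0)"
    by (auto intro!: tendsto_eq_intros)
  show "\<forall>\<^sub>F t in at_right 0. a \<le> b + t * c"
    using eventually_at_right_real[OF zero_less_one] by (rule eventually_mono) (auto intro: assms)
qed simp

lemma inner_transpose: "(transpose A *v u) \<bullet> x = u \<bullet> (A *v x)"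
  for A :: "real^'n^'m"
  by (simp add: transpose_matrix_vector dot_lmul_matrix)

lemma convex_funD:
  assumes "convex_fun g" and "g x \<le> ereal r" and "g y \<le> ereal s" and "0 \<le> t" and "t \<le> 1"
  shows "g (x + t *\<^sub>R (y - x)) \<le> ereal (r + t * (s - r))"
proof -
  have "(1 - t) *\<^sub>R (x, r) + t *\<^sub>R (y, s) \<in> ereal_epigraph g"
    using assms unfolding convex_fun_def by (intro convexD) (auto simp: ereal_epigraph_def)
  moreover have "(1 - t) *\<^sub>R x + t *\<^sub>R y = x + t *\<^sub>R (y - x)"
    and "(1 - t) * r + t * s = r + t * (s - r)"
    by (simp_all add: algebra_simps)
  ultimately show ?thesis by (simp add: ereal_epigraph_def)
qed

section \<open>Positive multiples of closed proper convex functions\<close>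

text \<open>Written as a preimage under a linear continuous map that rescales heights, the epigraph
  inherits closedness and convexity at once.\<close>

lemma ereal_epigraph_scale:
  fixes c :: real
  assumes "0 < c"
  shows "ereal_epigraph (\<lambda>x. ereal c * g x) = (\<lambda>(x, r). (x, r / c)) -` ereal_epigraph g"
proof -
  have "ereal c * g x \<le> ereal r \<longleftrightarrow> g x \<le> ereal (r / c)" for x r
    using assms by (cases "g x") (auto simp: field_simps)
  then show ?thesis by (auto simp: ereal_epigraph_def)
qed

lemma closed_fun_scale:
  fixes c :: real
  assumes "0 < c" and "closed_fun g"
  shows "closed_fun (\<lambda>x. ereal c * g x)"
  unfolding closed_fun_def ereal_epigraph_scale[OF assms(1)]
  using assms by (intro closed_vimage)
    (auto simp: closed_fun_def case_prod_beta intro!: continuous_intros)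

lemma convex_fun_scale:
  fixes c :: real
  assumes "0 < c" and "convex_fun g"
  shows "convex_fun (\<lambda>x. ereal c * g x)"
  unfolding convex_fun_def ereal_epigraph_scale[OF assms(1)]
  using assms by (intro convex_linear_vimage)
    (auto simp: convex_fun_def case_prod_beta add_divide_distrib intro!: linearI)

lemma proper_fun_scale:
  fixes c :: real
  assumes "0 < c" and "proper_fun g"
  shows "proper_fun (\<lambda>x. ereal c * g x)"
  using assms by (auto simp: proper_fun_def ereal_mult_eq_MInfty ereal_mult_eq_PInfty)

lemma proper_fun_finite_at:
  assumes "proper_fun g"
  obtains x r where "g x = ereal r"
  using assms unfolding proper_fun_def by (metis ereal_cases)

section \<open>Existence and optimality of the proximal point\<close>

text \<open>Separate the epigraph from a point one unit below the graph. The minorant later makes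
  sublevel sets of the proximal objective bounded.\<close>

lemma closed_convex_affine_minorant:
  fixes g :: "'a::euclidean_space \<Rightarrow> ereal"
  assumes "closed_fun g" and "proper_fun g" and "convex_fun g"
  shows "\<exists>c q. \<forall>x r. g x \<le> ereal r \<longrightarrow> c - q \<bullet> x \<le> r"
proof -
  obtain a r where a: "g a = ereal r" using assms(2) by (rule proper_fun_finite_at)
  have "(a, r - 1) \<notin> ereal_epigraph g" by (simp add: ereal_epigraph_def a)
  then obtain P b where P: "P \<bullet> (a, r - 1) < b" "\<And>z. z \<in> ereal_epigraph g \<Longrightarrow> b < P \<bullet> z"
    using separating_hyperplane_closed_point[of "ereal_epigraph g" "(a, r - 1)"] assms
    unfolding closed_fun_def convex_fun_def by blast
  obtain p s where ps: "P = (p, s)" by (cases P)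
  have "b < p \<bullet> a + s * r" using P(2)[of "(a, r)"] by (simp add: ps ereal_epigraph_def a)
  moreover have "p \<bullet> a + s * (r - 1) < b" using P(1) by (simp add: ps)
  \<comment> \<open>\<open>(a, r)\<close> and \<open>(a, r - 1)\<close> lie strictly on opposite
    sides, so the hyperplane is not vertical and can be normalized by \<open>s\<close>.\<close>
  ultimately have s: "0 < s" by (simp add: algebra_simps)
  have "b / s - (p /\<^sub>R s) \<bullet> x \<le> r" if "g x \<le> ereal r" for x r
  proof -
    have "b < p \<bullet> x + s * r" using P(2)[of "(x, r)"] that by (simp add: ps ereal_epigraph_def)
    then show ?thesis using s by (simp add: field_simps)
  qed
  then show ?thesis by blast
qed

text \<open>\<open>prox\<close> is a choice among minimizers, so one has to exist. The Weierstrass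
  argument runs on the epigraph, where the objective becomes the continuous real function
  \<open>F\<close> and closedness of \<open>g\<close> applies directly.\<close>

lemma prox_is_arg_min:
  fixes g :: "'a::euclidean_space \<Rightarrow> ereal"
  assumes "closed_fun g" and "proper_fun g" and "convex_fun g"
  shows "is_arg_min (\<lambda>x. ereal (1 / 2 * (norm (y - x))\<^sup>2) + g x) (\<lambda>_. True) (prox g y)"
proof -
  obtain q c where qc: "\<And>x r. g x \<le> ereal r \<Longrightarrow> c - q \<bullet> x \<le> r"
    using closed_convex_affine_minorant[OF assms] by blast
  obtain a r where a: "g a = ereal r" using assms(2) by (rule proper_fun_finite_at)
  define F where "F = (\<lambda>(x, r). 1 / 2 * (norm (y - x))\<^sup>2 + r :: real)"
  define S where "S = ereal_epigraph g \<inter> {z. F z \<le> F (a, r)}"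
  have contF: "continuous_on X F" for X
    unfolding F_def case_prod_beta by (intro continuous_intros)
  have "closed S"
    unfolding S_def using assms(1) contF
    by (intro closed_Int closed_Collect_le) (auto simp: closed_fun_def)
  moreover have "bounded S"
  proof -
    \<comment> \<open>Insert the affine minorant into the sublevel bound and complete the square
      around \<open>y + q\<close>.\<close>
    define R where "R = 2 * F (a, r) + 2 * (q \<bullet> y) - 2 * c + (norm q)\<^sup>2"
    have "norm (x - (y + q)) \<le> sqrt R \<and> \<bar>s\<bar> \<le> \<bar>F (a, r)\<bar> + \<bar>c\<bar> + norm q * (norm (y + q) + sqrt R)"
      if "(x, s) \<in> S" for x s
    proof -
      have le: "1 / 2 * (norm (y - x))\<^sup>2 + s \<le> F (a, r)" "c - q \<bullet> x \<le> s"
        using that qc by (auto simp: S_def ereal_epigraph_def F_def)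
      have "(norm (x - (y + q)))\<^sup>2 = (norm (y - x))\<^sup>2 - 2 * (q \<bullet> x) + 2 * (q \<bullet> y) + (norm q)\<^sup>2"
        by (simp add: power2_norm_eq_inner inner_simps inner_commute algebra_simps)
      also have "\<dots> \<le> R" using le by (simp add: R_def)
      finally have 1: "norm (x - (y + q)) \<le> sqrt R" by (rule real_le_rsqrt)
      have "norm x \<le> norm (y + q) + sqrt R"
        using norm_triangle_ineq[of "x - (y + q)" "y + q"] 1 by simp
      then have "\<bar>q \<bullet> x\<bar> \<le> norm q * (norm (y + q) + sqrt R)"
        by (meson Cauchy_Schwarz_ineq2 mult_left_mono norm_ge_zero order_trans)
      moreover have "s \<le> F (a, r)" using le(1) zero_le_power2[of "norm (y - x)"] by linarith
      ultimately have "\<bar>s\<bar> \<le> \<bar>F (a, r)\<bar> + \<bar>c\<bar> + norm q * (norm (y + q) + sqrt R)"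
        using le(2) by linarith
      with 1 show ?thesis by blast
    qed
    then have "S \<subseteq> cball (y + q) (sqrt R)
        \<times> cball 0 (\<bar>F (a, r)\<bar> + \<bar>c\<bar> + norm q * (norm (y + q) + sqrt R))"
      by (auto simp: dist_norm norm_minus_commute)
    then show ?thesis by (rule bounded_subset[rotated]) (intro bounded_Times bounded_cball)
  qed
  ultimately have "compact S" by (simp add: compact_eq_bounded_closed)
  moreover have "(a, r) \<in> S" by (simp add: S_def ereal_epigraph_def a)
  ultimately obtain z where z: "z \<in> S" "\<And>v. v \<in> S \<Longrightarrow> F z \<le> F v"
    using continuous_attains_inf[OF _ _ contF, of S] by blast
  obtain p s where ps: "z = (p, s)" by (cases z)
  \<comment> \<open>Pairs of the epigraph outside \<open>S\<close> have a value above
    \<open>F (a, r)\<close>, hence above \<open>F z\<close>.\<close>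
  have min: "F (p, s) \<le> F (x, u)" if "g x \<le> ereal u" for x u
  proof (cases "(x, u) \<in> S")
    case False
    then show ?thesis using that z(1) by (auto simp: S_def ps ereal_epigraph_def)
  qed (use z ps in auto)
  have gp: "g p \<le> ereal s" using z(1) by (simp add: S_def ps ereal_epigraph_def)
  have "is_arg_min (\<lambda>x. ereal (1 / 2 * (norm (y - x))\<^sup>2) + g x) (\<lambda>_. True) p"
    unfolding is_arg_min_linorder
  proof (intro conjI allI impI TrueI)
    fix x
    have "ereal (1 / 2 * (norm (y - p))\<^sup>2) + g p \<le> ereal (F (p, s))"
      using gp by (cases "g p") (auto simp: F_def)
    also have "\<dots> \<le> ereal (1 / 2 * (norm (y - x))\<^sup>2) + g x"
    proof (cases "g x")
      case (real u)
      then show ?thesis using min[of x u] by (simp add: F_def)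
    qed (use assms(2) in \<open>auto simp: proper_fun_def\<close>)
    finally show "ereal (1 / 2 * (norm (y - p))\<^sup>2) + g p
      \<le> ereal (1 / 2 * (norm (y - x))\<^sup>2) + g x" .
  qed
  then show ?thesis unfolding prox_def arg_min_def by (rule someI)
qed

text \<open>Compare \<open>p\<close> with the point a fraction \<open>t\<close> of the way to
  \<open>x\<close>: convexity bounds \<open>g\<close> there linearly in \<open>t\<close>, and the
  squared distance contributes the inner product plus a remainder of order \<open>t\<close>
  squared.\<close>

lemma prox_subgradient:
  fixes g :: "'a::euclidean_space \<Rightarrow> ereal" and y :: 'a
  assumes "closed_fun g" and "proper_fun g" and "convex_fun g"
  defines "p \<equiv> prox g y"
  shows "\<bar>g p\<bar> \<noteq> \<infinity>" and "g p + ereal ((y - p) \<bullet> (x - p)) \<le> g x"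
proof -
  have min: "ereal (1 / 2 * (norm (y - p))\<^sup>2) + g p \<le> ereal (1 / 2 * (norm (y - x))\<^sup>2) + g x" for x
    using prox_is_arg_min[OF assms(1-3), of y] unfolding p_def is_arg_min_linorder by blast
  obtain a r where "g a = ereal r" using assms(2) by (rule proper_fun_finite_at)
  then have "g p \<noteq> \<infinity>" using min[of a] by auto
  then show fin: "\<bar>g p\<bar> \<noteq> \<infinity>" using assms(2) by (auto simp: proper_fun_def)
  then obtain s where s: "g p = ereal s" by auto
  have norm_sq: "(norm (u - t *\<^sub>R v))\<^sup>2 = (norm u)\<^sup>2 - 2 * t * (u \<bullet> v) + t\<^sup>2 * (norm v)\<^sup>2"
    for u v :: 'a and t
    unfolding power2_norm_eq_inner
    by (simp add: inner_simps inner_commute power2_eq_square algebra_simps)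
  show "g p + ereal ((y - p) \<bullet> (x - p)) \<le> g x"
  proof (cases "g x")
    case (real u)
    have "s + (y - p) \<bullet> (x - p) - u \<le> 0"
    proof (rule real_le_of_le_add_scaled)
      fix t :: real assume t: "0 < t" "t < 1"
      let ?z = "p + t *\<^sub>R (x - p)"
      have "g ?z \<le> ereal (s + t * (u - s))"
        using s real t by (intro convex_funD[OF assms(3)]) auto
      then have "ereal (1 / 2 * (norm (y - p))\<^sup>2) + ereal s
          \<le> ereal (1 / 2 * (norm (y - ?z))\<^sup>2) + ereal (s + t * (u - s))"
        using min[of ?z] unfolding s by (rule order_trans[OF _ add_left_mono, rotated])
      moreover have "(norm (y - ?z))\<^sup>2
          = (norm (y - p))\<^sup>2 - 2 * t * ((y - p) \<bullet> (x - p)) + t\<^sup>2 * (norm (x - p))\<^sup>2"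
        using norm_sq[of "y - p" t "x - p"] by (simp add: algebra_simps)
      ultimately have "t * (s + (y - p) \<bullet> (x - p) - u) \<le> t * (0 + t * ((norm (x - p))\<^sup>2 / 2))"
        by (simp add: algebra_simps power2_eq_square)
      then show "s + (y - p) \<bullet> (x - p) - u \<le> 0 + t * ((norm (x - p))\<^sup>2 / 2)"
        using t by (simp only: mult_le_cancel_left_pos)
    qed
    then show ?thesis by (simp add: s real)
  qed (use assms(2) in \<open>auto simp: proper_fun_def\<close>)
qed

section \<open>Convex conjugates and the Moreau envelope\<close>

lemma Fenchel_Young: "ereal (y \<bullet> x) - g x \<le> convex_conjugate g y"
  unfolding convex_conjugate_def by (rule SUP_upper) simp

text \<open>The subgradient inequality says that the supremum is attained at \<open>z\<close>: this
  is the equality case of Fenchel-Young.\<close>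

lemma convex_conjugate_le_of_subgradient:
  assumes "\<And>x. g z + ereal (p \<bullet> (x - z)) \<le> g x" and "g z = ereal s"
  shows "convex_conjugate g p \<le> ereal (p \<bullet> z - s)"
  unfolding convex_conjugate_def
proof (rule SUP_least)
  fix x
  show "ereal (p \<bullet> x) - g x \<le> ereal (p \<bullet> z - s)"
    using assms(1)[of x] assms(2) by (cases "g x") (auto simp: inner_diff_right)
qed

text \<open>A supremum of affine functions of \<open>y\<close> is convex. Real upper bounds
  \<open>a\<close> and \<open>b\<close> avoid arithmetic with infinities.\<close>

lemma convex_conjugate_segment:
  assumes "\<And>x. \<bar>g x\<bar> \<noteq> \<infinity>" and "convex_conjugate g y \<le> ereal a" and "convex_conjugate g z \<le> ereal b"
    and "0 \<le> t" and "t \<le> 1"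
  shows "convex_conjugate g (y + t *\<^sub>R (z - y)) \<le> ereal (a + t * (b - a))"
  unfolding convex_conjugate_def
proof (rule SUP_least)
  fix x
  obtain u where u: "g x = ereal u" using assms(1)[of x] by auto
  have "y \<bullet> x - u \<le> a" "z \<bullet> x - u \<le> b"
    using order_trans[OF Fenchel_Young[of y x g] assms(2)]
      order_trans[OF Fenchel_Young[of z x g] assms(3)] by (simp_all add: u)
  then have "(1 - t) * (y \<bullet> x - u) + t * (z \<bullet> x - u) \<le> (1 - t) * a + t * b"
    using assms(4,5) by (intro add_mono mult_left_mono) auto
  then show "ereal ((y + t *\<^sub>R (z - y)) \<bullet> x) - g x \<le> ereal (a + t * (b - a))"
    by (simp add: u inner_simps algebra_simps)
qed

text \<open>The envelope of the conjugate is differentiable with gradient \<open>prox g\<close>; only the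
  upper quadratic expansion is needed.\<close>

lemma moreau_envelope_conjugate:
  fixes g :: "'a::euclidean_space \<Rightarrow> ereal" and y :: 'a
  assumes "closed_fun g" and "proper_fun g" and "convex_fun g"
  defines "p \<equiv> prox g y"
  obtains P where "moreau_envelope (convex_conjugate g) y = ereal P"
    and "\<And>d. moreau_envelope (convex_conjugate g) (y + d) \<le> ereal (P + p \<bullet> d + 1 / 2 * (norm d)\<^sup>2)"
proof -
  note sub = prox_subgradient[OF assms(1-3), of y, folded p_def]
  obtain s where s: "g p = ereal s" using sub(1) by auto
  \<comment> \<open>By Moreau's decomposition \<open>y - p\<close> solves the envelope problem at
    \<open>y\<close>; \<open>P\<close> is the value there.\<close>
  define P where "P = (y - p) \<bullet> p - s + 1 / 2 * (norm p)\<^sup>2"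
  have conj: "convex_conjugate g (y - p) \<le> ereal ((y - p) \<bullet> p - s)"
    using sub(2) s by (rule convex_conjugate_le_of_subgradient)
  \<comment> \<open>Keep \<open>y - p\<close> as trial point for the shifted argument
    \<open>y + d\<close>.\<close>
  have up: "moreau_envelope (convex_conjugate g) (y + d) \<le> ereal (P + p \<bullet> d + 1 / 2 * (norm d)\<^sup>2)" for d
  proof -
    have "moreau_envelope (convex_conjugate g) (y + d)
        \<le> convex_conjugate g (y - p) + ereal (1 / 2 * (norm ((y - p) - (y + d)))\<^sup>2)"
      unfolding moreau_envelope_def by (rule INF_lower) simp
    also have "\<dots> \<le> ereal ((y - p) \<bullet> p - s) + ereal (1 / 2 * (norm ((y - p) - (y + d)))\<^sup>2)"
      using conj by (rule add_right_mono)
    also have "\<dots> = ereal (P + p \<bullet> d + 1 / 2 * (norm d)\<^sup>2)"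
      by (simp add: P_def power2_norm_eq_inner inner_simps inner_commute algebra_simps)
    finally show ?thesis .
  qed
  have "ereal P \<le> moreau_envelope (convex_conjugate g) y"
    unfolding moreau_envelope_def
  proof (rule INF_greatest)
    fix x
    \<comment> \<open>With the conjugate replaced by its Fenchel-Young bound at \<open>p\<close>,
      the excess over \<open>P\<close> is half a square centred at \<open>y - p\<close>.\<close>
    have "2 * (x \<bullet> p - s + 1 / 2 * (norm (x - y))\<^sup>2) - 2 * P = (norm (x - (y - p)))\<^sup>2"
      by (simp add: P_def power2_norm_eq_inner inner_simps inner_commute algebra_simps)
    then have "0 \<le> 2 * (x \<bullet> p - s + 1 / 2 * (norm (x - y))\<^sup>2) - 2 * P"
      by (simp only: zero_le_power2)
    then have "P \<le> x \<bullet> p - s + 1 / 2 * (norm (x - y))\<^sup>2" by simp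
    then have "ereal P \<le> (ereal (x \<bullet> p) - g p) + ereal (1 / 2 * (norm (x - y))\<^sup>2)"
      by (simp add: s)
    also have "\<dots> \<le> convex_conjugate g x + ereal (1 / 2 * (norm (x - y))\<^sup>2)"
      by (intro add_right_mono Fenchel_Young)
    finally show "ereal P \<le> convex_conjugate g x + ereal (1 / 2 * (norm (x - y))\<^sup>2)" .
  qed
  moreover have "moreau_envelope (convex_conjugate g) y \<le> ereal P" using up[of 0] by simp
  ultimately show ?thesis using up that by (meson antisym)
qed

section \<open>Subgradients of the loss\<close>

text \<open>Restrict to the line through \<open>z\<close> and \<open>x\<close> and apply the tangent
  inequality in one variable.\<close>

lemma gradient_subgradient:
  fixes h :: "'a::real_inner \<Rightarrow> real"
  assumes "strictly_convex_fun (\<lambda>x. ereal (h x))" and "GDERIV h z :> p"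
  shows "h z + p \<bullet> (x - z) \<le> h x"
proof -
  have conv: "h ((1 - t) *\<^sub>R a + t *\<^sub>R b) \<le> (1 - t) * h a + t * h b" if "0 < t" "t < 1" for a b t
  proof (cases "a = b")
    case False
    with that show ?thesis using assms(1)
      unfolding strictly_convex_fun_def effective_domain_def by (auto intro: less_imp_le)
  qed (simp flip: scaleR_left_distrib distrib_right)
  define k where "k = (\<lambda>t. h (z + t *\<^sub>R (x - z)))"
  have "convex_on UNIV k"
  proof (rule convex_onI)
    fix t a b :: real assume "0 < t" "t < 1"
    have "z + ((1 - t) *\<^sub>R a + t *\<^sub>R b) *\<^sub>R (x - z)
        = (1 - t) *\<^sub>R (z + a *\<^sub>R (x - z)) + t *\<^sub>R (z + b *\<^sub>R (x - z))"
      by (simp add: algebra_simps)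
    then show "k ((1 - t) *\<^sub>R a + t *\<^sub>R b) \<le> (1 - t) * k a + t * k b"
      using conv[OF \<open>0 < t\<close> \<open>t < 1\<close>] by (simp only: k_def)
  qed simp
  moreover have "(k has_real_derivative p \<bullet> (x - z)) (at 0)"
  proof -
    have "(h has_derivative (\<lambda>v. p \<bullet> v)) (at (z + 0 *\<^sub>R (x - z)))"
      using assms(2) by (simp add: gderiv_def inner_commute)
    then have "(k has_derivative (\<lambda>t. p \<bullet> (t *\<^sub>R (x - z)))) (at 0)"
      unfolding k_def
      by (rule has_derivative_compose[rotated]) (auto intro!: derivative_eq_intros)
    then show ?thesis by (simp add: has_field_derivative_def mult.commute[of _ "p \<bullet> (x - z)"])
  qed
  ultimately have "k 1 - k 0 \<ge> p \<bullet> (x - z) * (1 - 0)"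
    by (intro convex_on_imp_above_tangent[where A = UNIV]) auto
  then show ?thesis by (simp add: k_def)
qed

text \<open>Testing minimality along the segment from \<open>- \<alpha>\<close> to the gradient of \<open>fl\<close> at \<open>A *v x\<close>
  yields the subgradient of \<open>fl\<close> directly, without biconjugation.\<close>

lemma inner_minimizer_subgradient:
  fixes fl :: "real^'m \<Rightarrow> ereal" and A :: "real^'n^'m"
  assumes strict: "strictly_convex_fun fl" and lip: "lipschitz_gradient L fl"
    and c: "0 < c"
    and g: "closed_fun (\<phi> (lam * c))" "proper_fun (\<phi> (lam * c))" "convex_fun (\<phi> (lam * c))"
    and min: "is_arg_min (inner_objective fl \<phi> A lam c w) (\<lambda>_. True) \<alpha>"
    and x: "x = prox (\<phi> (lam * c)) (w + c *\<^sub>R (transpose A *v \<alpha>))"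
  shows "fl (A *v x) + ereal (- \<alpha> \<bullet> (z - A *v x)) \<le> fl z"
proof -
  define h where "h = (\<lambda>x. real_of_ereal (fl x))"
  have fin: "\<bar>fl z\<bar> \<noteq> \<infinity>" for z using lip by (simp add: lipschitz_gradient_def)
  have fl: "fl = (\<lambda>z. ereal (h z))" using fin by (auto simp: h_def ereal_real)
  obtain p where "GDERIV h (A *v x) :> p"
    using lip by (auto simp: lipschitz_gradient_def h_def)
  then have p: "h (A *v x) + p \<bullet> (z - A *v x) \<le> h z" for z
    using strict unfolding fl by (intro gradient_subgradient)
  let ?f = "convex_conjugate fl"
  define y where "y = w + c *\<^sub>R (transpose A *v \<alpha>)"
  obtain P where P: "moreau_envelope (convex_conjugate (\<phi> (lam * c))) y = ereal P"
    "\<And>d. moreau_envelope (convex_conjugate (\<phi> (lam * c))) (y + d)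
       \<le> ereal (P + x \<bullet> d + 1 / 2 * (norm d)\<^sup>2)"
    using moreau_envelope_conjugate[OF g, of y] unfolding x y_def by blast
  have fp: "?f p \<le> ereal (p \<bullet> (A *v x) - h (A *v x))"
    using p by (intro convex_conjugate_le_of_subgradient) (auto simp: fl)
  \<comment> \<open>Minimality of \<open>\<alpha>\<close> against \<open>\<alpha> + v\<close>, with
    the envelope replaced by its quadratic upper bound of slope \<open>x\<close>. The step
    \<open>d\<close> is \<open>c\<close> times \<open>transpose A *v v\<close>, so the weight
    \<open>1 / c\<close> leaves the linear term free of \<open>c\<close>.\<close>
  have key: "?f (- \<alpha>) + ereal (P / c)
      \<le> ?f (- (\<alpha> + v)) + ereal (P / c + (A *v x) \<bullet> v + c / 2 * (norm (transpose A *v v))\<^sup>2)" for v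
  proof -
    have "?f (- \<alpha>) + ereal (P / c) = inner_objective fl \<phi> A lam c w \<alpha>"
      using P(1) by (simp add: inner_objective_def y_def)
    also have "\<dots> \<le> inner_objective fl \<phi> A lam c w (\<alpha> + v)"
      using min unfolding is_arg_min_linorder by blast
    also have "\<dots> = ?f (- (\<alpha> + v)) + ereal (1 / c) *
        moreau_envelope (convex_conjugate (\<phi> (lam * c))) (y + c *\<^sub>R (transpose A *v v))"
      by (simp add: inner_objective_def y_def matrix_vector_right_distrib algebra_simps)
    also have "\<dots> \<le> ?f (- (\<alpha> + v)) + ereal (1 / c) *
        ereal (P + x \<bullet> (c *\<^sub>R (transpose A *v v)) + 1 / 2 * (norm (c *\<^sub>R (transpose A *v v)))\<^sup>2)"
      using c by (intro add_left_mono ereal_mult_left_mono P(2)) auto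
    also have "ereal (1 / c) *
        ereal (P + x \<bullet> (c *\<^sub>R (transpose A *v v)) + 1 / 2 * (norm (c *\<^sub>R (transpose A *v v)))\<^sup>2)
        = ereal (P / c + x \<bullet> (transpose A *v v) + c / 2 * (norm (transpose A *v v))\<^sup>2)"
      using c by (simp add: power2_eq_square field_simps)
    also have "x \<bullet> (transpose A *v v) = (A *v x) \<bullet> v"
      by (metis inner_transpose inner_commute)
    finally show ?thesis .
  qed
  have "?f (- \<alpha>) \<noteq> -\<infinity>" using Fenchel_Young[of "- \<alpha>" 0 fl] by (auto simp: fl)
  \<comment> \<open>This \<open>v\<close> moves the conjugate's argument to \<open>p\<close>, where
    \<open>fp\<close> bounds it.\<close>
  moreover have "?f (- \<alpha>) \<noteq> \<infinity>" using key[of "- p - \<alpha>"] fp by auto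
  ultimately obtain a where a: "?f (- \<alpha>) = ereal a" by (cases "?f (- \<alpha>)") auto
  define b where "b = p \<bullet> (A *v x) - h (A *v x)"
  \<comment> \<open>Direction for which \<open>- (\<alpha> + t *\<^sub>R v)\<close> runs from
    \<open>- \<alpha>\<close> to \<open>p\<close>.\<close>
  define v where "v = - p - \<alpha>"
  have "a - b - (A *v x) \<bullet> v \<le> 0"
  proof (rule real_le_of_le_add_scaled)
    fix t :: real assume t: "0 < t" "t < 1"
    have "?f (- \<alpha> + t *\<^sub>R (p - - \<alpha>)) \<le> ereal (a + t * (b - a))"
      using fin a fp t unfolding b_def by (intro convex_conjugate_segment) auto
    moreover have "- \<alpha> + t *\<^sub>R (p - - \<alpha>) = - (\<alpha> + t *\<^sub>R v)"
      by (simp add: v_def algebra_simps)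
    ultimately have "?f (- (\<alpha> + t *\<^sub>R v)) \<le> ereal (a + t * (b - a))"
      by (simp only:)
    then have "ereal a + ereal (P / c) \<le> ereal (a + t * (b - a)) + ereal (P / c
        + (A *v x) \<bullet> (t *\<^sub>R v) + c / 2 * (norm (transpose A *v (t *\<^sub>R v)))\<^sup>2)"
      using key[of "t *\<^sub>R v"] unfolding a by (rule order_trans[OF _ add_right_mono, rotated])
    then have "t * (a - b - (A *v x) \<bullet> v) \<le> t * (0 + t * (c / 2 * (norm (transpose A *v v))\<^sup>2))"
      by (simp add: matrix_vector_mult_scaleR power2_eq_square algebra_simps)
    then show "a - b - (A *v x) \<bullet> v \<le> 0 + t * (c / 2 * (norm (transpose A *v v))\<^sup>2)"
      using t by (simp only: mult_le_cancel_left_pos)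
  qed
  \<comment> \<open>In \<open>b + (A *v x) \<bullet> v\<close> the \<open>p\<close> terms cancel, so
    \<open>a\<close> is at most \<open>- \<alpha> \<bullet> (A *v x) - h (A *v x)\<close>;
    Fenchel-Young at \<open>z\<close> closes the chain.\<close>
  moreover have "- \<alpha> \<bullet> z - h z \<le> a" using Fenchel_Young[of "- \<alpha>" z fl] a by (simp add: fl)
  ultimately show ?thesis
    by (simp add: fl b_def v_def inner_simps inner_commute)
qed

section \<open>One DAL step as a proximal point step\<close>

text \<open>Add the proximal optimality condition, divided by \<open>c\<close>, to the subgradient
  inequality of the loss. Moving \<open>transpose A\<close> across the inner product makes the
  \<open>\<alpha>\<close> terms cancel.\<close>

lemma dal_step:
  fixes fl :: "real^'m \<Rightarrow> ereal" and A :: "real^'n^'m"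
  assumes strict: "strictly_convex_fun fl" and lip: "lipschitz_gradient L fl"
    and c: "0 < c"
    and g: "closed_fun (\<phi> lam)" "proper_fun (\<phi> lam)" "convex_fun (\<phi> lam)"
    and scale: "\<phi> (lam * c) = (\<lambda>x. ereal c * \<phi> lam x)"
    and min: "is_arg_min (inner_objective fl \<phi> A lam c w) (\<lambda>_. True) \<alpha>"
    and x: "x = prox (\<phi> (lam * c)) (w + c *\<^sub>R (transpose A *v \<alpha>))"
  shows "\<bar>objective fl \<phi> A lam x\<bar> \<noteq> \<infinity>"
    and "objective fl \<phi> A lam x + ereal ((w - x) \<bullet> (z - x) / c) \<le> objective fl \<phi> A lam z"
proof -
  have gc: "closed_fun (\<phi> (lam * c))" "proper_fun (\<phi> (lam * c))" "convex_fun (\<phi> (lam * c))"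
    unfolding scale using c g by (simp_all add: closed_fun_scale proper_fun_scale convex_fun_scale)
  have fl: "fl (A *v x) + ereal (- \<alpha> \<bullet> (A *v z - A *v x)) \<le> fl (A *v z)"
    by (rule inner_minimizer_subgradient[OF strict lip c gc min x])
  have fin: "\<bar>fl z\<bar> \<noteq> \<infinity>" for z using lip by (simp add: lipschitz_gradient_def)
  note sub = prox_subgradient[OF gc, of "w + c *\<^sub>R (transpose A *v \<alpha>)", folded x]
  obtain s where s: "\<phi> lam x = ereal s"
    using sub(1) c unfolding scale by (cases "\<phi> lam x") auto
  obtain u v where u: "fl (A *v x) = ereal u" and v: "fl (A *v z) = ereal v"
    using fin[of "A *v x"] fin[of "A *v z"] by auto
  show "\<bar>objective fl \<phi> A lam x\<bar> \<noteq> \<infinity>" by (simp add: objective_def s u)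
  show "objective fl \<phi> A lam x + ereal ((w - x) \<bullet> (z - x) / c) \<le> objective fl \<phi> A lam z"
  proof (cases "\<phi> lam z")
    case (real r)
    have "c * s + (w + c *\<^sub>R (transpose A *v \<alpha>) - x) \<bullet> (z - x) \<le> c * r"
      using sub(2)[of z] by (simp add: scale s real)
    moreover have "(w + c *\<^sub>R (transpose A *v \<alpha>) - x) \<bullet> (z - x)
        = (w - x) \<bullet> (z - x) + c * ((transpose A *v \<alpha>) \<bullet> (z - x))"
      by (simp only: inner_add_left inner_diff_left inner_scaleR_left)
    moreover have "(transpose A *v \<alpha>) \<bullet> (z - x) = \<alpha> \<bullet> (A *v z - A *v x)"
      by (simp only: inner_transpose matrix_vector_mult_diff_distrib)
    ultimately have "c * s + (w - x) \<bullet> (z - x) + c * (\<alpha> \<bullet> (A *v z - A *v x)) \<le> c * r"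
      by (simp only: add.assoc)
    then have "s + (w - x) \<bullet> (z - x) / c + \<alpha> \<bullet> (A *v z - A *v x) \<le> r"
      using c by (simp add: field_simps)
    moreover have "u - \<alpha> \<bullet> (A *v z - A *v x) \<le> v" using fl by (simp add: u v)
    ultimately show ?thesis by (simp add: objective_def s u v real)
  qed (use g(2) fin v in \<open>auto simp: objective_def proper_fun_def\<close>)
qed

section \<open>Growth of the weights and the telescoping rate\<close>

text \<open>The last summand alone gives the lower bound. Above, each of the \<open>k + 1\<close>
  summands is at most the last, and \<open>k + 1 \<le> 2 ^ k\<close> is absorbed by doubling the
  ratio.\<close>

lemma grows_exponentially_sum:
  fixes \<eta> :: "nat \<Rightarrow> real"
  assumes pos: "\<And>t. 0 < \<eta> t" and inc: "incseq \<eta>" and "grows_exponentially \<eta>"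
  shows "grows_exponentially (\<lambda>k. \<Sum>t=0..k. \<eta> t)"
proof -
  obtain a r b s where *: "0 < a" "1 < r" "\<And>t. a * r ^ t \<le> \<eta> t" "\<And>t. \<eta> t \<le> b * s ^ t"
    using assms(3) unfolding grows_exponentially_def by blast
  have lo: "a * r ^ k \<le> (\<Sum>t=0..k. \<eta> t)" for k
    using *(3)[of k] member_le_sum[of k "{0..k}" \<eta>] less_imp_le[OF pos] by fastforce
  have up: "(\<Sum>t=0..k. \<eta> t) \<le> b * (2 * s) ^ k" for k
  proof -
    have "(\<Sum>t=0..k. \<eta> t) \<le> (\<Sum>t=0..k. \<eta> k)"
      using inc by (intro sum_mono) (auto simp: incseq_def)
    also have "\<dots> = real (Suc k) * \<eta> k" by simp
    also have "\<dots> \<le> 2 ^ k * (b * s ^ k)"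
    proof (rule mult_mono)
      show "real (Suc k) \<le> 2 ^ k"
        using less_exp[of k] by (metis Suc_leI of_nat_le_iff of_nat_numeral of_nat_power)
    qed (use * less_imp_le[OF pos] in auto)
    finally show ?thesis by (simp add: power_mult_distrib mult_ac)
  qed
  show ?thesis unfolding grows_exponentially_def using *(1,2) lo up by blast
qed

text \<open>Here \<open>v\<close> stands for a minimizer and \<open>m\<close> for the minimum.
  Values are compared from index 1 on, since the objective may be infinite at
  \<open>w 0\<close>.\<close>

lemma proximal_point_rate:
  fixes w :: "nat \<Rightarrow> 'a::real_inner" and F :: "nat \<Rightarrow> real"
  assumes pos: "\<And>t. 0 < \<eta> t"
    and opt: "\<And>t. F (Suc t) + (w t - w (Suc t)) \<bullet> (v - w (Suc t)) / \<eta> t \<le> m"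
    and dec: "\<And>t. F (Suc (Suc t)) \<le> F (Suc t)"
  shows "2 * (\<Sum>t=0..k. \<eta> t) * (F (Suc k) - m) \<le> (norm (w 0 - v))\<^sup>2"
proof -
  have step: "2 * \<eta> t * (F (Suc t) - m) \<le> (norm (w t - v))\<^sup>2 - (norm (w (Suc t) - v))\<^sup>2" for t
  proof -
    have "\<eta> t * (F (Suc t) - m) \<le> - ((w t - w (Suc t)) \<bullet> (v - w (Suc t)))"
      using opt[of t] pos[of t] by (simp add: field_simps)
    \<comment> \<open>Three-point identity; dropping the squared step length leaves a telescoping
      difference.\<close>
    moreover have "- 2 * ((w t - w (Suc t)) \<bullet> (v - w (Suc t)))
        = (norm (w t - v))\<^sup>2 - (norm (w (Suc t) - v))\<^sup>2 - (norm (w t - w (Suc t)))\<^sup>2"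
      by (simp add: power2_norm_eq_inner inner_simps inner_commute algebra_simps)
    ultimately show ?thesis using zero_le_power2[of "norm (w t - w (Suc t))"] by linarith
  qed
  have "2 * (\<Sum>t=0..k. \<eta> t) * (F (Suc k) - m) \<le> (norm (w 0 - v))\<^sup>2 - (norm (w (Suc k) - v))\<^sup>2"
  proof (induction k)
    case 0
    then show ?case using step[of 0] by simp
  next
    case (Suc k)
    \<comment> \<open>Monotonicity transfers the accumulated weight to the newest gap.\<close>
    have "2 * (\<Sum>t=0..k. \<eta> t) * (F (Suc (Suc k)) - m) \<le> 2 * (\<Sum>t=0..k. \<eta> t) * (F (Suc k) - m)"
      using dec[of k] less_imp_le[OF pos] by (intro mult_left_mono) (auto intro!: sum_nonneg)
    with Suc step[of "Suc k"] show ?case by (simp add: algebra_simps)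
  qed
  then show ?thesis using zero_le_power2[of "norm (w (Suc k) - v)"] by linarith
qed

section \<open>Convergence of the DAL iterates\<close>

theorem theorem2:
  fixes fl :: "real^'m \<Rightarrow> ereal"
    and \<phi> :: "real \<Rightarrow> real^'n \<Rightarrow> ereal"
    and A :: "real^'n^'m"
    and lam \<gamma> :: real
    and \<eta> :: "nat \<Rightarrow> real"
    and w :: "nat \<Rightarrow> real^'n"
    and \<alpha> :: "nat \<Rightarrow> real^'m"
  defines "f \<equiv> objective fl \<phi> A lam"
    and "C \<equiv> (\<lambda>k. \<Sum>t=0..k. \<eta> t)"
  assumes "0 < lam" and "0 < \<gamma>"
    and "closed_fun fl" and "proper_fun fl" and "strictly_convex_fun fl"
    and "lipschitz_gradient (1 / \<gamma>) fl"
    and "essentially_twice_differentiable (convex_conjugate fl)"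
    and "closed_fun (\<phi> lam)" and "proper_fun (\<phi> lam)" and "convex_fun (\<phi> lam)"
    and "\<And>c x. 0 < c \<Longrightarrow> \<phi> (c * lam) x = ereal c * \<phi> lam x"
    and "minimizers f \<noteq> {}"
    and "\<And>t. 0 < \<eta> t" and "incseq \<eta>" and "grows_exponentially \<eta>"
    and "dal_sequence fl \<phi> A lam \<eta> w \<alpha>"
  shows "(\<forall>k. f (w (k + 1)) - (INF v. f v) \<le> ereal ((infdist (w 0) (minimizers f))\<^sup>2 / (2 * C k))) \<and>
    grows_exponentially C \<and>
    decays_exponentially (\<lambda>k. f (w (k + 1)) - (INF v. f v))"
proof -
  obtain v where v: "v \<in> minimizers f" using assms(14) by blast
  have fv_le: "f u \<le> f x" if "u \<in> minimizers f" for u x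
    using that by (auto simp: minimizers_def is_arg_min_linorder)
  have Inf_eq: "(INF x. f x) = f u" if "u \<in> minimizers f" for u
    using fv_le[OF that] by (intro antisym INF_lower INF_greatest) auto
  have scale: "\<phi> (lam * \<eta> t) = (\<lambda>x. ereal (\<eta> t) * \<phi> lam x)" for t
    using assms(13)[OF assms(15)[of t]] by (auto simp: mult.commute)
  have dal: "is_arg_min (inner_objective fl \<phi> A lam (\<eta> t) (w t)) (\<lambda>_. True) (\<alpha> t)"
    "w (Suc t) = prox (\<phi> (lam * \<eta> t)) (w t + \<eta> t *\<^sub>R (transpose A *v \<alpha> t))" for t
    using assms(18) unfolding dal_sequence_def by blast+
  note step = dal_step[OF assms(7,8,15,10,11,12) scale dal, folded f_def]
  \<comment> \<open>\<open>F 0\<close> may be the default value 0 of an infinite objective; only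
    indices from 1 on are converted back.\<close>
  define F where "F = (\<lambda>t. real_of_ereal (f (w t)))"
  have F: "f (w (Suc t)) = ereal (F (Suc t))" for t
    using step(1)[of t] by (simp add: F_def ereal_real)
  \<comment> \<open>The minimum is finite: \<open>f (w 1)\<close> bounds it above, the first
    subgradient inequality bounds it below.\<close>
  have "f v \<noteq> \<infinity>" using fv_le[OF v, of "w 1"] F[of 0] by auto
  moreover have "f v \<noteq> -\<infinity>" using step(2)[of 0 v] F[of 0] by auto
  ultimately obtain m where m: "f v = ereal m" by (cases "f v") auto
  have gap: "f (w (k + 1)) - (INF v. f v) = ereal (F (Suc k) - m)" for k
    by (simp add: Inf_eq[OF v] m F)
  have gap_nonneg: "0 \<le> F (Suc k) - m" for k
    using fv_le[OF v, of "w (Suc k)"] by (simp add: F m)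
  have C_pos: "0 < C k" for k
    unfolding C_def using assms(15) by (intro sum_pos) auto
  have dec: "F (Suc (Suc t)) \<le> F (Suc t)" for t
  proof -
    \<comment> \<open>Test the subgradient at the previous iterate, so that the inner product
      becomes a square.\<close>
    have "F (Suc (Suc t)) + (norm (w (Suc t) - w (Suc (Suc t))))\<^sup>2 / \<eta> (Suc t) \<le> F (Suc t)"
      using step(2)[of "Suc t" "w (Suc t)"] by (simp add: F power2_norm_eq_inner)
    moreover have "0 \<le> (norm (w (Suc t) - w (Suc (Suc t))))\<^sup>2 / \<eta> (Suc t)"
      using assms(15) by (simp add: less_imp_le)
    ultimately show ?thesis by linarith
  qed
  have rate: "F (Suc k) - m \<le> (infdist (w 0) (minimizers f))\<^sup>2 / (2 * C k)" for k
  proof -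
    \<comment> \<open>Taking the root first gives a lower bound on the distance to every minimizer,
      which passes to the infimum.\<close>
    have "sqrt (2 * C k * (F (Suc k) - m)) \<le> dist (w 0) u" if u: "u \<in> minimizers f" for u
    proof -
      have "f u = ereal m" using Inf_eq[OF u] Inf_eq[OF v] m by simp
      then have "F (Suc t) + (w t - w (Suc t)) \<bullet> (u - w (Suc t)) / \<eta> t \<le> m" for t
        using step(2)[of t u] by (simp add: F)
      then have "2 * C k * (F (Suc k) - m) \<le> (norm (w 0 - u))\<^sup>2"
        unfolding C_def using assms(15) dec by (intro proximal_point_rate)
      then show ?thesis by (simp add: dist_norm real_le_lsqrt)
    qed
    then have "sqrt (2 * C k * (F (Suc k) - m)) \<le> infdist (w 0) (minimizers f)"
      unfolding infdist_notempty[OF assms(14)] by (intro cINF_greatest assms(14))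
    then have "2 * C k * (F (Suc k) - m) \<le> (infdist (w 0) (minimizers f))\<^sup>2"
      by (rule sqrt_le_D)
    then show ?thesis using C_pos[of k] by (simp add: field_simps)
  qed
  have C_grows: "grows_exponentially C"
    unfolding C_def using assms(15-17) by (rule grows_exponentially_sum)
  then obtain a r where ar: "0 < a" "1 < r" "\<And>k. a * r ^ k \<le> C k"
    unfolding grows_exponentially_def by blast
  define D where "D = (infdist (w 0) (minimizers f))\<^sup>2"
  \<comment> \<open>Only the geometric lower bound on \<open>C\<close> enters, giving decay ratio
    \<open>1 / r\<close>.\<close>
  have "F (Suc k) - m \<le> D / (2 * a) * (1 / r) ^ k" for k
  proof -
    have "F (Suc k) - m \<le> D / (2 * C k)" using rate by (simp add: D_def)
    also have "\<dots> \<le> D / (2 * (a * r ^ k))"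
      using ar by (intro divide_left_mono mult_left_mono mult_pos_pos C_pos) (auto simp: D_def)
    also have "\<dots> = D / (2 * a) * (1 / r) ^ k" by (simp add: power_divide)
    finally show ?thesis .
  qed
  then have "decays_exponentially (\<lambda>k. f (w (k + 1)) - (INF v. f v))"
    unfolding decays_exponentially_def gap using gap_nonneg ar
    by (intro exI[of _ "D / (2 * a)"] exI[of _ "1 / r"]) auto
  then show ?thesis using rate C_grows by (simp only: gap ereal_less_eq) blast
qed

end
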